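(* Let $A\in\mathcal P_n$. For each $C\in C_{\mathcal P_n}(A)$ define the $C$-sector $$\mathcal Q_C(A)=\{Q\in\mathcal P_n:\ Q^3=(QA)^2=C\}.$$ Then the set $\mathcal S_P(A)$ is the disjoint union $$\mathcal S_P(A)=\bigcup_{C\in C_{\mathcal P_n}(A)}A^{-1}\mathcal Q_C(A).$$ Equivalently, for $X\in\mathcal P_n$: $X\in\mathcal S_P(A)$ if and only if, for $Q=AX$, there exists a unique $C\in C_{\mathcal P_n}(A)$ such that $Q^3=(QA)^2=C$. In that case, $X=A^{-1}Q=QAQ^{-1}$. In particular, every $X\in\mathcal S_P(A)$ is permutation-similar to $A$ (i.e. $X=PAP^{-1}$ for some $P\in\mathcal P_n$) and hence has the same cycle type as $A$.
   Context: $\mathcal P_n$ is the group of all $n\times n$ permutation matrices; a matrix $L\in\mathcal P_n$ corresponds to the permutation $\pi_L\in S_n$ with $Le_i=e_{\pi_L(i)}$, and the cycle type of $L$ is that of $\pi_L$. $C_{\mathcal P_n}(A)=\{B\in\mathcal P_n: AB=BA\}$ is the centralizer of $A$ in $\mathcal P_n$. $\mathcal S_P(A)=\{X\in\mathcal P_n: AXA=XAX\}$. $A^{-1}\mathcal Q_C(A)=\{A^{-1}Q:Q\in\mathcal Q_C(A)\}$. *)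

theory Defs
  imports "HOL-Analysis.Analysis" "HOL-Combinatorics.Orbits"
begin

text \<open>The index type \<open>'n\<close> plays the role of \<open>{1..n}\<close>, and the entries 0 and 1 live in an arbitrary
  field. There is no power operation on this matrix type, so squares and cubes are written out as
  products.\<close>

definition perm_matrices :: "('a::field ^ 'n ^ 'n) set" where
  "perm_matrices = {L. (\<forall>i j. L $ i $ j \<in> {0, 1})
     \<and> (\<forall>i. \<exists>!j. L $ i $ j = 1) \<and> (\<forall>j. \<exists>!i. L $ i $ j = 1)}"

definition perm_of_matrix :: "'a::field ^ 'n ^ 'n \<Rightarrow> 'n \<Rightarrow> 'n" where
  "perm_of_matrix L = (THE p. p permutes UNIV \<and> (\<forall>i. L *v axis i 1 = axis (p i) 1))"

text \<open>The description in the previous definition does determine a permutation:\<close>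

lemma perm_of_matrix_unique:
  fixes L :: "'a::field ^ 'n ^ 'n"
  assumes "L \<in> perm_matrices"
  shows "\<exists>!p. p permutes UNIV \<and> (\<forall>i. L *v axis i 1 = axis (p i) 1)"
proof -
  have ent: "L $ i $ j = 0 \<or> L $ i $ j = 1" for i j
    using assms by (auto simp: perm_matrices_def)
  have row: "\<exists>!j. L $ i $ j = 1" and col: "\<exists>!j. L $ j $ i = 1" for i
    using assms by (auto simp: perm_matrices_def)
  define p where "p j = (THE i. L $ i $ j = 1)" for j
  have p: "L $ i $ j = 1 \<longleftrightarrow> p j = i" for i j
    using theI'[OF col[of j]] the1_equality[OF col[of j]] unfolding p_def by fast
  have "bij p"
    unfolding bij_iff using row by (simp only: p) simp
  hence perm: "p permutes UNIV"
    by (simp add: permutes_def bij_iff)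
  have entry: "L $ i $ j = (if i = p j then 1 else 0)" for i j
    using ent[of i j] p[of i j] by (cases "p j = i") auto
  have "(L *v axis j 1) $ i = L $ i $ j" for i j
    by (simp add: matrix_vector_mult_def axis_def if_distrib cong: if_cong)
  hence act: "L *v axis j 1 = axis (p j) 1" for j
    by (simp add: vec_eq_iff entry) (simp add: axis_def)
  show ?thesis
  proof (rule ex1I[of _ p])
    show "p permutes UNIV \<and> (\<forall>i. L *v axis i 1 = axis (p i) 1)"
      using perm act by blast
  next
    fix q assume "q permutes UNIV \<and> (\<forall>i. L *v axis i 1 = axis (q i) 1)"
    hence "axis (q i) (1::'a) = axis (p i) 1" for i
      by (metis act)
    thus "q = p"
      by (simp add: axis_eq_axis fun_eq_iff)
  qed
qed

lemma
  fixes L :: "'a::field ^ 'n ^ 'n"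
  assumes "L \<in> perm_matrices"
  shows perm_of_matrix_permutes: "perm_of_matrix L permutes UNIV"
    and perm_of_matrix_axis: "L *v axis i 1 = axis (perm_of_matrix L i) 1"
  using theI'[OF perm_of_matrix_unique[OF assms]] unfolding perm_of_matrix_def [symmetric] by blast+

text \<open>The multiset of the cycle lengths; a fixed point is a singleton orbit and contributes a 1.\<close>

definition cycle_type :: "('n::finite \<Rightarrow> 'n) \<Rightarrow> nat multiset" where
  "cycle_type p = image_mset card (mset_set (range (orbit p)))"

definition perm_centralizer :: "'a::field ^ 'n ^ 'n \<Rightarrow> ('a ^ 'n ^ 'n) set" where
  "perm_centralizer A = {B \<in> perm_matrices. A ** B = B ** A}"

definition perm_solutions :: "'a::field ^ 'n ^ 'n \<Rightarrow> ('a ^ 'n ^ 'n) set" where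
  "perm_solutions A = {X \<in> perm_matrices. A ** X ** A = X ** A ** X}"

definition sector :: "'a::field ^ 'n ^ 'n \<Rightarrow> 'a ^ 'n ^ 'n \<Rightarrow> ('a ^ 'n ^ 'n) set" where
  "sector A C = {Q \<in> perm_matrices. Q ** Q ** Q = (Q ** A) ** (Q ** A) \<and> (Q ** A) ** (Q ** A) = C}"

end

theory Submission
  imports Defs
begin

text \<open>
  Put \<open>Q = AX\<close>. With the common left factor \<open>AXA\<close> taken out,
  \<open>Q\<^sup>3 = (AXA) (XAX)\<close> and \<open>(QA)\<^sup>2 = (AXA) (AXA)\<close>, so, as \<open>A\<close> and \<open>X\<close> are invertible, the sector
  equation \<open>Q\<^sup>3 = (QA)\<^sup>2\<close> is the braid relation \<open>AXA = XAX\<close> itself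
  (\<open>braid_iff_cube_eq_square\<close>). The value \<open>C = (AXA)\<^sup>2\<close> is determined by \<open>X\<close>, which gives
  uniqueness and disjointness. That \<open>C\<close> commutes with \<open>A\<close> is the classical fact that the square of
  the half twist \<open>M = AXA = XAX\<close> is central in the braid group on three strands: \<open>M\<close> satisfies
  \<open>AM = MX\<close> and \<open>XM = MA\<close>, so \<open>M\<^sup>2\<close> commutes with both generators.

  The braid relation also reads \<open>QA = XQ\<close>, that is \<open>X = QAQ\<^sup>-\<^sup>1\<close>. Thus \<open>X\<close> is similar to \<open>A\<close> by a
  permutation matrix. Passing to permutations, \<open>Q\<close> gives a bijection carrying the orbits of
  \<open>\<pi>\<^sub>A\<close> onto those of \<open>\<pi>\<^sub>X\<close>, so the cycle types agree.
\<close>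

section \<open>Inverses of matrices\<close>

lemma
  fixes A :: "'a::semiring_1 ^ 'n ^ 'm"
  assumes "invertible A"
  shows invertible_matrix_inv_right: "A ** matrix_inv A = mat 1"
    and invertible_matrix_inv_left: "matrix_inv A ** A = mat 1"
  using someI_ex[OF assms[unfolded invertible_def]] unfolding matrix_inv_def by blast+

lemma matrix_inv_mult_cancel_left:
  fixes A :: "'a::semiring_1 ^ 'n ^ 'm"
  assumes "invertible A"
  shows "matrix_inv A ** (A ** B) = B"
  by (simp add: matrix_mul_assoc invertible_matrix_inv_left[OF assms])

lemma mult_matrix_inv_cancel_left:
  fixes A :: "'a::semiring_1 ^ 'n ^ 'm"
  assumes "invertible A"
  shows "A ** (matrix_inv A ** B) = B"
  by (simp add: matrix_mul_assoc invertible_matrix_inv_right[OF assms])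

lemma invertible_mult_left_cancel:
  fixes A :: "'a::semiring_1 ^ 'n ^ 'm"
  assumes "invertible A"
  shows "A ** B = A ** C \<longleftrightarrow> B = C"
  by (metis matrix_inv_mult_cancel_left[OF assms])

lemma matrix_inv_eqI:
  fixes A :: "'a::semiring_1 ^ 'n ^ 'm"
  assumes "A ** B = mat 1" "B ** A = mat 1"
  shows "matrix_inv A = B"
  using matrix_inv_mult_cancel_left[of A B] assms by (auto simp: invertible_def)

section \<open>The braid relation\<close>

text \<open>Both sides of the sector equation begin with \<open>AXA\<close>; its factors are invertible, and what is
  left after cancelling them is the braid relation.\<close>

lemma braid_iff_cube_eq_square:
  fixes A X :: "'a::semiring_1 ^ 'n ^ 'n"
  assumes "invertible A" "invertible X" and Q: "Q = A ** X"
  shows "A ** X ** A = X ** A ** X \<longleftrightarrow> Q ** Q ** Q = (Q ** A) ** (Q ** A)"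
proof -
  have "Q ** Q ** Q = A ** (X ** (A ** (X ** A ** X)))"
    and "(Q ** A) ** (Q ** A) = A ** (X ** (A ** (A ** X ** A)))"
    by (simp_all add: Q matrix_mul_assoc)
  thus ?thesis
    using assms(1,2) by (auto simp: invertible_mult_left_cancel)
qed

text \<open>Each generator passes through \<open>M = AXA = XAX\<close> at the price of turning into the other one,
  because \<open>A (XAX) = (AXA) X\<close> and \<open>(AXA) A = (XAX) A = X (AXA)\<close>; passing through \<open>M\<close> twice
  restores it.\<close>

lemma braid_square_commutes:
  fixes A X :: "'a::semiring_1 ^ 'n ^ 'n"
  assumes braid: "A ** X ** A = X ** A ** X" and M: "M = A ** X ** A"
  shows "A ** (M ** M) = (M ** M) ** A"
proof -
  have AM: "A ** M = M ** X"
  proof -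
    have "A ** M = A ** (X ** A ** X)"
      by (simp only: M braid)
    also have "\<dots> = M ** X"
      by (simp only: M matrix_mul_assoc)
    finally show ?thesis .
  qed
  have XM: "X ** M = M ** A"
  proof -
    have "X ** M = (X ** A ** X) ** A"
      by (simp only: M matrix_mul_assoc)
    also have "\<dots> = M ** A"
      by (simp only: M braid)
    finally show ?thesis .
  qed
  have "A ** (M ** M) = M ** (X ** M)"
    by (simp only: matrix_mul_assoc AM)
  also have "\<dots> = (M ** M) ** A"
    by (simp only: XM matrix_mul_assoc)
  finally show ?thesis .
qed

text \<open>The braid relation, bracketed as \<open>(AX) A = X (AX)\<close>, says that \<open>AX\<close> conjugates \<open>A\<close> to \<open>X\<close>.\<close>

lemma braid_conjugation:
  fixes A X :: "'a::semiring_1 ^ 'n ^ 'n"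
  assumes braid: "A ** X ** A = X ** A ** X" and "invertible (A ** X)"
  shows "X = (A ** X) ** A ** matrix_inv (A ** X)"
proof -
  have "(A ** X) ** A ** matrix_inv (A ** X) = X ** ((A ** X) ** matrix_inv (A ** X))"
    using braid by (simp add: matrix_mul_assoc)
  thus ?thesis
    by (simp add: invertible_matrix_inv_right[OF assms(2)])
qed

section \<open>Permutation matrices and permutations\<close>

definition matrix_of_perm :: "('n \<Rightarrow> 'n) \<Rightarrow> 'a::field ^ 'n ^ 'n" where
  "matrix_of_perm p = (\<chi> i j. if i = p j then 1 else 0)"

lemma matrix_of_perm_mem: "bij p \<Longrightarrow> matrix_of_perm p \<in> perm_matrices"
  by (auto simp: perm_matrices_def matrix_of_perm_def bij_iff) metis+

lemma bij_perm_of_matrix: "L \<in> perm_matrices \<Longrightarrow> bij (perm_of_matrix L)"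
  by (rule permutes_bij[OF perm_of_matrix_permutes])

lemma matrix_of_perm_of_matrix:
  fixes L :: "'a::field ^ 'n ^ 'n"
  assumes "L \<in> perm_matrices"
  shows "matrix_of_perm (perm_of_matrix L) = L"
proof -
  have "L $ i $ j = (L *v axis j 1) $ i" for i j
    by (simp add: matrix_vector_mult_def axis_def if_distrib cong: if_cong)
  thus ?thesis
    unfolding perm_of_matrix_axis[OF assms] by (simp add: vec_eq_iff matrix_of_perm_def axis_def)
qed

lemma matrix_of_perm_mult:
  "matrix_of_perm p ** matrix_of_perm q = (matrix_of_perm (p \<circ> q) :: 'a::field ^ 'n ^ 'n)"
  by (simp add: vec_eq_iff matrix_matrix_mult_def matrix_of_perm_def
      if_distrib[of "\<lambda>x. _ * x"] cong: if_cong)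

lemma matrix_of_perm_id: "matrix_of_perm id = (mat 1 :: 'a::field ^ 'n ^ 'n)"
  by (simp add: vec_eq_iff matrix_of_perm_def mat_def)

lemma matrix_of_perm_inject:
  "(matrix_of_perm p :: 'a::field ^ 'n ^ 'n) = matrix_of_perm q \<longleftrightarrow> p = q"
proof
  assume eq: "(matrix_of_perm p :: 'a ^ 'n ^ 'n) = matrix_of_perm q"
  show "p = q"
  proof
    fix j
    have "(matrix_of_perm p :: 'a ^ 'n ^ 'n) $ p j $ j = matrix_of_perm q $ p j $ j"
      by (simp add: eq)
    thus "p j = q j"
      by (simp add: matrix_of_perm_def split: if_splits)
  qed
qed simp

lemma
  fixes L M :: "'a::field ^ 'n ^ 'n"
  assumes "L \<in> perm_matrices" "M \<in> perm_matrices"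
  shows perm_matrices_mult: "L ** M \<in> perm_matrices"
    and perm_of_matrix_mult: "perm_of_matrix (L ** M) = perm_of_matrix L \<circ> perm_of_matrix M"
proof -
  have LM: "L ** M = matrix_of_perm (perm_of_matrix L \<circ> perm_of_matrix M)"
    using assms by (metis matrix_of_perm_mult matrix_of_perm_of_matrix)
  show mem: "L ** M \<in> perm_matrices"
    unfolding LM using assms by (intro matrix_of_perm_mem bij_comp bij_perm_of_matrix)
  show "perm_of_matrix (L ** M) = perm_of_matrix L \<circ> perm_of_matrix M"
    using LM matrix_of_perm_of_matrix[OF mem] by (metis matrix_of_perm_inject)
qed

lemma
  fixes L :: "'a::field ^ 'n ^ 'n"
  assumes "L \<in> perm_matrices"
  shows perm_matrices_invertible: "invertible L"
    and perm_matrices_inv: "matrix_inv L \<in> perm_matrices"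
proof -
  let ?p = "perm_of_matrix L"
  have bij: "bij ?p"
    by (rule bij_perm_of_matrix[OF assms])
  have "matrix_of_perm ?p ** matrix_of_perm (inv ?p) = (mat 1 :: 'a ^ 'n ^ 'n)"
    and "matrix_of_perm (inv ?p) ** matrix_of_perm ?p = (mat 1 :: 'a ^ 'n ^ 'n)"
    using bij by (simp_all add: matrix_of_perm_mult matrix_of_perm_id
        surj_iff[THEN iffD1, OF bij_is_surj] inj_iff[THEN iffD1, OF bij_is_inj])
  hence inv: "L ** matrix_of_perm (inv ?p) = mat 1" "matrix_of_perm (inv ?p) ** L = mat 1"
    by (simp_all add: matrix_of_perm_of_matrix[OF assms])
  show "invertible L"
    using inv by (auto simp: invertible_def)
  show "matrix_inv L \<in> perm_matrices"
    using matrix_inv_eqI[OF inv] bij by (simp add: matrix_of_perm_mem bij_imp_bij_inv)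
qed

section \<open>Cycle types of conjugate permutations\<close>

lemma orbit_image_semiconj:
  assumes "f \<circ> r = r \<circ> g"
  shows "orbit f (r x) = r ` orbit g x"
proof -
  have "(f ^^ n) (r x) = r ((g ^^ n) x)" for n
    using assms by (induction n) (simp_all add: fun_eq_iff)
  thus ?thesis
    by (auto simp: orbit_altdef)
qed

text \<open>The direct image under \<open>r\<close> is an injection on sets that preserves cardinalities, and it maps
  the orbits of \<open>g\<close> onto those of \<open>f\<close>.\<close>

lemma cycle_type_conj:
  fixes f g r :: "'n::finite \<Rightarrow> 'n"
  assumes "bij r" and semiconj: "f \<circ> r = r \<circ> g"
  shows "cycle_type f = cycle_type g"
proof -
  have inj: "inj r" and surj: "surj r"
    using assms(1) by (auto simp: bij_def)
  \<comment> \<open>As \<open>r\<close> is onto, every orbit of \<open>f\<close> starts at some \<open>r x\<close>.\<close>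
  have "range (orbit f) = range (orbit f \<circ> r)"
    by (simp only: image_comp[symmetric] surj)
  also have "\<dots> = (image r) ` range (orbit g)"
    by (auto simp: orbit_image_semiconj[OF semiconj])
  finally have "mset_set (range (orbit f)) = image_mset (image r) (mset_set (range (orbit g)))"
    by (simp only: image_mset_mset_set[OF inj_on_image[OF inj_on_subset[OF inj subset_UNIV]]])
  moreover have "card (r ` S) = card S" for S
    by (rule card_image[OF inj_on_subset[OF inj subset_UNIV]])
  ultimately show ?thesis
    by (simp add: cycle_type_def multiset.map_comp comp_def)
qed

section \<open>The sector decomposition\<close>

theorem theorem2p1:
  fixes A :: "'a::field ^ 'n ^ 'n"
  assumes "A \<in> perm_matrices"
  shows "perm_solutions A = (\<Union>C\<in>perm_centralizer A. (\<lambda>Q. matrix_inv A ** Q) ` sector A C)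
    \<and> disjoint_family_on (\<lambda>C. (\<lambda>Q. matrix_inv A ** Q) ` sector A C) (perm_centralizer A)
    \<and> (\<forall>X\<in>perm_matrices. X \<in> perm_solutions A \<longleftrightarrow>
         (let Q = A ** X in
           \<exists>!C. C \<in> perm_centralizer A \<and> Q ** Q ** Q = (Q ** A) ** (Q ** A) \<and> (Q ** A) ** (Q ** A) = C))
    \<and> (\<forall>X\<in>perm_solutions A. 
         (let Q = A ** X in X = matrix_inv A ** Q \<and> X = Q ** A ** matrix_inv Q))
    \<and> (\<forall>X\<in>perm_solutions A. \<exists>P\<in>perm_matrices. X = P ** A ** matrix_inv P)
    \<and> (\<forall>X\<in>perm_solutions A. cycle_type (perm_of_matrix X) = cycle_type (perm_of_matrix A))"
proof -
  note invA = perm_matrices_invertible[OF assms]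
  have char: "X \<in> perm_solutions A \<longleftrightarrow>
      (A ** X) ** (A ** X) ** (A ** X) = ((A ** X) ** A) ** ((A ** X) ** A)"
    if "X \<in> perm_matrices" for X
    using braid_iff_cube_eq_square[OF invA perm_matrices_invertible[OF that] refl] that
    by (simp add: perm_solutions_def)
  have central: "((A ** X) ** A) ** ((A ** X) ** A) \<in> perm_centralizer A"
    if "X \<in> perm_solutions A" for X
  proof -
    have PX: "X \<in> perm_matrices" and braid: "A ** X ** A = X ** A ** X"
      using that by (simp_all add: perm_solutions_def)
    show ?thesis
      unfolding perm_centralizer_def
      by (intro CollectI conjI perm_matrices_mult assms PX braid_square_commutes[OF braid refl])
  qed
  have conj: "X = (A ** X) ** A ** matrix_inv (A ** X)" if "X \<in> perm_solutions A" for X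
    using that assms
    by (intro braid_conjugation)
      (simp_all add: perm_solutions_def perm_matrices_mult perm_matrices_invertible)

  have union: "perm_solutions A = (\<Union>C\<in>perm_centralizer A. (\<lambda>Q. matrix_inv A ** Q) ` sector A C)"
  proof (intro set_eqI iffI)
    fix X assume X: "X \<in> perm_solutions A"
    hence PX: "X \<in> perm_matrices"
      by (simp add: perm_solutions_def)
    have "A ** X \<in> sector A (((A ** X) ** A) ** ((A ** X) ** A))"
      using X char[OF PX] perm_matrices_mult[OF assms PX] by (simp add: sector_def)
    moreover have "X = matrix_inv A ** (A ** X)"
      by (simp add: matrix_inv_mult_cancel_left[OF invA])
    ultimately show "X \<in> (\<Union>C\<in>perm_centralizer A. (\<lambda>Q. matrix_inv A ** Q) ` sector A C)"
      using central[OF X] by blast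
  next
    fix X assume "X \<in> (\<Union>C\<in>perm_centralizer A. (\<lambda>Q. matrix_inv A ** Q) ` sector A C)"
    then obtain Q where Q: "Q \<in> perm_matrices" "Q ** Q ** Q = (Q ** A) ** (Q ** A)"
      and X: "X = matrix_inv A ** Q"
      by (auto simp: sector_def)
    have AX: "A ** X = Q"
      by (simp add: X mult_matrix_inv_cancel_left[OF invA])
    have "X \<in> perm_matrices"
      unfolding X by (rule perm_matrices_mult[OF perm_matrices_inv[OF assms] Q(1)])
    from char[OF this] show "X \<in> perm_solutions A"
      unfolding AX using Q(2) by blast
  qed

  have disjoint: "disjoint_family_on (\<lambda>C. (\<lambda>Q. matrix_inv A ** Q) ` sector A C) (perm_centralizer A)"
  proof -
    have "C = D" if "Q \<in> sector A C" "R \<in> sector A D" "matrix_inv A ** Q = matrix_inv A ** R"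
      for C D Q R
    proof -
      have "Q = R"
        using that(3) by (metis mult_matrix_inv_cancel_left[OF invA])
      with that(1,2) show ?thesis
        unfolding sector_def by blast
    qed
    thus ?thesis
      unfolding disjoint_family_on_def by blast
  qed

  have unique: "X \<in> perm_solutions A \<longleftrightarrow> (let Q = A ** X in \<exists>!C. C \<in> perm_centralizer A
      \<and> Q ** Q ** Q = (Q ** A) ** (Q ** A) \<and> (Q ** A) ** (Q ** A) = C)"
    if "X \<in> perm_matrices" for X
    using char[OF that] central[of X] unfolding Let_def by blast

  have similar: "\<exists>P\<in>perm_matrices. X = P ** A ** matrix_inv P" if "X \<in> perm_solutions A" for X
  proof (rule bexI)
    show "X = (A ** X) ** A ** matrix_inv (A ** X)"
      by (rule conj[OF that])
    show "A ** X \<in> perm_matrices"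
      using that by (simp add: perm_solutions_def perm_matrices_mult[OF assms])
  qed

  have cycles: "cycle_type (perm_of_matrix X) = cycle_type (perm_of_matrix A)"
    if "X \<in> perm_solutions A" for X
  proof -
    have PX: "X \<in> perm_matrices" and braid: "A ** X ** A = X ** A ** X"
      using that by (simp_all add: perm_solutions_def)
    have PQ: "A ** X \<in> perm_matrices"
      by (rule perm_matrices_mult[OF assms PX])
    have "perm_of_matrix (X ** (A ** X)) = perm_of_matrix ((A ** X) ** A)"
      by (simp add: braid matrix_mul_assoc)
    hence "perm_of_matrix X \<circ> perm_of_matrix (A ** X) = perm_of_matrix (A ** X) \<circ> perm_of_matrix A"
      by (simp add: perm_of_matrix_mult[OF PX PQ] perm_of_matrix_mult[OF PQ assms])
    thus ?thesis
      by (rule cycle_type_conj[OF bij_perm_of_matrix[OF PQ]])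
  qed

  show ?thesis
    unfolding Let_def matrix_inv_mult_cancel_left[OF invA]
    using union disjoint unique[unfolded Let_def] similar cycles conj
    by (intro conjI ballI refl) assumption+
qed

end
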